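(* In the setting described in the context, use the distributed controllers $\bar u_i^*(k)=K_i\hat E_i(k)$ and observers with gains $L_1,\dots,L_N$ such that the block matrix $A_c$, whose $i$-th diagonal block is $\tilde A+\tilde BK-\tilde B_iK_i-L_iH_i$ and whose $(i,l)$ block for $l\neq i$ is $-\tilde B_lK_l$, is asymptotically stable (spectral radius $<1$). Then the corresponding cost is $$J^{\star}(s,\infty)=E^T(s)PE(s)+\sum_{k=s}^{\infty}\begin{bmatrix}E(k)\\ \tilde E(k)\end{bmatrix}^T\begin{bmatrix}0&\mathcal M_1\\ \mathcal M_1^T&\mathcal M_2\end{bmatrix}\begin{bmatrix}E(k)\\ \tilde E(k)\end{bmatrix}.$$ Moreover, the difference between this cost and the cost $J^*(s,\infty)=E^T(s)PE(s)$ under the centralized optimal control is $$\Delta J(s,\infty)=J^{\star}(s,\infty)-J^{*}(s,\infty)=\sum_{k=s}^{\infty}\begin{bmatrix}E(k)\\ \tilde E(k)\end{bmatrix}^T\begin{bmatrix}0&\mathcal M_1\\ \mathcal M_1^T&\mathcal M_2\end{bmatrix}\begin{bmatrix}E(k)\\ \tilde E(k)\end{bmatrix}.$$ In particular, $\Delta J(s,\infty)\to0$ as $s\to\infty$; that is, the proposed consensus controller achieves the optimal cost asymptotically.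
   Context: **Agents and graph.** There are $N$ followers $x_i(k+1)=A_ix_i(k)+B_iu_i(k)$, $i=1,\dots,N$, with $x_i(k)\in\mathbb R^n$, $u_i(k)\in\mathbb R^m$, $A_i\in\mathbb R^{n\times n}$, $B_i\in\mathbb R^{n\times m}$, and a leader $x_0(k+1)=A_0x_0(k)$ with $x_0(k)\in\mathbb R^n$; by convention $B_0=0$ (and $u_0=0$). The agents $0,1,\dots,N$ interact over a directed graph; $\mathcal N_i$ denotes the set of neighbours of $i$, whose state and input agent $i$ can use. Standing assumption: the graph has a spanning tree with root $0$. Fix such a tree; for each follower $i$ let $j=j(i)\in\mathcal N_i$ be its parent in the tree. Only the edges of this tree are used. **Errors and feedforward.** Put $e_{ij}(k)=x_i(k)-x_j(k)$ for $j=j(i)$. The control is $u_i(k)=\tilde u_i(k)+\bar u_i(k)$, with feedforward part $\tilde u_i$ given, with $j=j(i)$, by: Case 1 ($B_i$ invertible) $\tilde u_i(k)=-B_i^{-1}(A_i-A_j)x_j(k)+B_i^{-1}B_ju_j(k)$; or Case 2 (the range of $[A_j-A_i,\ B_j]$ is contained in the range of $B_i$) $\tilde u_i(k)=-B_i^{\dagger}[(A_i-A_j)x_j(k)-B_ju_j(k)]+(I-B_i^{\dagger}B_i)z(k)$ with $z(k)$ arbitrary ($\dagger$: Moore-Penrose inverse). Each follower is assumed to be in Case 1 or Case 2. Then $e_{ij}(k+1)=A_ie_{ij}(k)+B_i\bar u_i(k)$. **Global error system.** $E(k)\in\mathbb R^{nN}$ is the stack, for $i=1,\dots,N$, of $e_{i\,j(i)}(k)$;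 $\bar u(k)$ is the stack of $\bar u_1(k),\dots,\bar u_N(k)$; $\tilde A=\mathrm{diag}\{A_1,\dots,A_N\}$, $\tilde B=\mathrm{diag}\{B_1,\dots,B_N\}$ (block diagonal), $\tilde B_i$ is the $i$-th block column of $\tilde B$. Thus $E(k+1)=\tilde AE(k)+\sum_{i=1}^N\tilde B_i\bar u_i(k)$. Agent $i$ measures $Y_i(k)=H_iE(k)$, with $H_i$ a given matrix composed of blocks $0$ and $I_n$. **Cost.** With symmetric weights $Q\ge0$, $R_i>0$, $\mathcal Q=I_N\otimes Q$, $R=\mathrm{diag}\{R_1,\dots,R_N\}$, the cost is $$J(s,\infty)=\sum_{k=s}^\infty\bigl[E^T(k)\mathcal QE(k)+\bar u^T(k)R\bar u(k)\bigr].$$ **Centralized optimal control.** $P$ is the unique positive definite solution of $$P=\tilde A^TP\tilde A+\mathcal Q-\tilde A^TP\tilde B(R+\tilde B^TP\tilde B)^{-1}\tilde B^TP\tilde A,$$ $K=-(R+\tilde B^TP\tilde B)^{-1}\tilde B^TP\tilde A$, and $K_i$ is the $i$-th block row ($m$ rows) of $K$. The centralized optimal control is $\bar u^*(k)=KE(k)$, and its cost from time $s$ starting at $E(s)$ is $J^*(s,\infty)=E^T(s)PE(s)$. **Distributed feedback and observers.** $\bar u_i(k)=\bar u_i^*(k)=K_i\hat E_i(k)$ with $$\hat E_i(k+1)=\tilde A\hat E_i(k)+\tilde B_i\bar u_i^*(k)+\sum_{l\ne i}\tilde B_lK_l\hat E_i(k)+L_i\bigl(Y_i(k)-H_i\hat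 E_i(k)\bigr),\quad i=1,\dots,N.$$ $J^\star(s,\infty)$ is the value of $J(s,\infty)$ along the resulting closed-loop trajectory. In the formulas, $E(k)$ is that trajectory, $\tilde E_i(k)=E(k)-\hat E_i(k)$, and $\tilde E(k)$ is the stack of $\tilde E_1(k),\dots,\tilde E_N(k)$; in $\Delta J(s,\infty)$, $J^*(s,\infty)$ is evaluated at the same $E(s)$. **Matrices.** $\Psi=[-\tilde B_1K_1\ \cdots\ -\tilde B_NK_N]$, $$\mathcal M_1=(\tilde A+\tilde BK)^TP\Psi-[K_1^TR_1K_1\ \cdots\ K_N^TR_NK_N],$$ $$\mathcal M_2=\mathrm{diag}\{K_1^TR_1K_1,\dots,K_N^TR_NK_N\}+\Psi^TP\Psi .$$ *)

theory Defs
  imports "HOL-Analysis.Analysis"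
begin

section \<open>Spanning trees of directed graphs\<close>

text \<open>
  A directed graph is a set of edges; an edge \<open>(j, i)\<close> means that \<open>i\<close> receives the data of \<open>j\<close>,
  that is, \<open>j\<close> is a neighbour of \<open>i\<close>. Trees are oriented away from the root.
\<close>

definition rooted_spanning_tree :: "('v \<times> 'v) set \<Rightarrow> 'v \<Rightarrow> ('v \<times> 'v) set \<Rightarrow> bool" where
  "rooted_spanning_tree G r T \<longleftrightarrow>
     T \<subseteq> G \<and> (\<forall>j. (j, r) \<notin> T) \<and> (\<forall>i. i \<noteq> r \<longrightarrow> (\<exists>!j. (j, i) \<in> T)) \<and> (\<forall>i. (r, i) \<in> T\<^sup>*)"

definition tree_parent :: "('v \<times> 'v) set \<Rightarrow> 'v \<Rightarrow> 'v" where
  "tree_parent T i = (THE j. (j, i) \<in> T)"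


section \<open>Block vectors and block matrices\<close>

text \<open>
  A vector with blocks indexed by \<open>'b\<close>, each of dimension \<open>'n\<close>, is indexed by \<open>'b \<times> 'n\<close>;
  a juxtaposition of two blocks of different sizes is indexed by a sum type.
\<close>

definition stack :: "('b::finite \<Rightarrow> 'a^'n) \<Rightarrow> 'a^('b \<times> 'n)" where
  "stack v = (\<chi> p. v (fst p) $ snd p)"

definition diag_blocks :: "('b::finite \<Rightarrow> 'a::zero^'c^'r) \<Rightarrow> 'a^('b \<times> 'c)^('b \<times> 'r)" where
  "diag_blocks M = (\<chi> p q. if fst p = fst q then M (fst p) $ snd p $ snd q else 0)"

definition blocks :: "('b::finite \<Rightarrow> 'd::finite \<Rightarrow> 'a^'c^'r) \<Rightarrow> 'a^('d \<times> 'c)^('b \<times> 'r)" where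
  "blocks M = (\<chi> p q. M (fst p) (fst q) $ snd p $ snd q)"

definition row_of_blocks :: "('d::finite \<Rightarrow> 'a^'c^'r) \<Rightarrow> 'a^('d \<times> 'c)^'r" where
  "row_of_blocks M = (\<chi> p q. M (fst q) $ p $ snd q)"

definition col_block :: "'a^('d::finite \<times> 'c)^'r \<Rightarrow> 'd \<Rightarrow> 'a^'c^'r" where
  "col_block M i = (\<chi> p q. M $ p $ (i, q))"

definition row_block :: "'a^'c^('b::finite \<times> 'r) \<Rightarrow> 'b \<Rightarrow> 'a^'c^'r" where
  "row_block M i = (\<chi> p q. M $ (i, p) $ q)"

definition kronecker :: "'a::times^'b::finite^'d::finite \<Rightarrow> 'a^'c^'r \<Rightarrow> 'a^('b \<times> 'c)^('d \<times> 'r)" where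
  "kronecker M N = (\<chi> p q. M $ fst p $ fst q * N $ snd p $ snd q)"

definition vec_join :: "'a^'n \<Rightarrow> 'a^'k \<Rightarrow> 'a^('n + 'k)" where
  "vec_join v w = (\<chi> p. case p of Inl i \<Rightarrow> v $ i | Inr i \<Rightarrow> w $ i)"

definition col_join :: "'a^'c^'r \<Rightarrow> 'a^'d^'r \<Rightarrow> 'a^('c + 'd)^'r" where
  "col_join M N = (\<chi> p. vec_join (M $ p) (N $ p))"

definition join_2x2 ::
  "'a^'c^'r \<Rightarrow> 'a^'d^'r \<Rightarrow> 'a^'c^'s \<Rightarrow> 'a^'d^'s \<Rightarrow> 'a^('c + 'd)^('r + 's)" where
  "join_2x2 M11 M12 M21 M22 =
     (\<chi> p. case p of Inl i \<Rightarrow> col_join M11 M12 $ i | Inr i \<Rightarrow> col_join M21 M22 $ i)"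


section \<open>Quadratic forms and definiteness\<close>

definition quad_form :: "real^'n^'n \<Rightarrow> real^'n \<Rightarrow> real" where
  "quad_form M v = v \<bullet> (M *v v)"

definition sym_pos_semidef :: "real^'n^'n \<Rightarrow> bool" where
  "sym_pos_semidef M \<longleftrightarrow> transpose M = M \<and> (\<forall>v. 0 \<le> quad_form M v)"

definition sym_pos_def :: "real^'n^'n \<Rightarrow> bool" where
  "sym_pos_def M \<longleftrightarrow> transpose M = M \<and> (\<forall>v. v \<noteq> 0 \<longrightarrow> 0 < quad_form M v)"


section \<open>Spectral radius\<close>

definition complex_spectrum :: "real^'n^'n \<Rightarrow> complex set" where
  "complex_spectrum M = {c. \<exists>v. v \<noteq> 0 \<and> (\<chi> i j. complex_of_real (M $ i $ j)) *v v = c *s v}"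

definition matrix_spectral_radius :: "real^'n^'n \<Rightarrow> real" where
  "matrix_spectral_radius M = (SUP c\<in>complex_spectrum M. cmod c)"


section \<open>Moore-Penrose inverse\<close>

definition penrose_conditions :: "real^'c^'r \<Rightarrow> real^'r^'c \<Rightarrow> bool" where
  "penrose_conditions M X \<longleftrightarrow>
     M ** X ** M = M \<and> X ** M ** X = X \<and>
     transpose (M ** X) = M ** X \<and> transpose (X ** M) = X ** M"

definition moore_penrose :: "real^'c^'r \<Rightarrow> real^'r^'c" where
  "moore_penrose M = (THE X. penrose_conditions M X)"

lemma matrix_inner_product_cancel:
  fixes M :: "real^'c^'r" and X Y :: "real^'k^'c"
  assumes "transpose M ** M ** X = transpose M ** M ** Y"
  shows "M ** X = M ** Y"
proof -
  have "M *v (X *v v) = M *v (Y *v v)" for v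
  proof -
    define w where "w = X *v v - Y *v v"
    have "(transpose M ** M) *v w = 0"
      using assms unfolding w_def
      by (simp add: matrix_vector_mult_diff_distrib matrix_vector_mul_assoc)
    then have "w \<bullet> (transpose M *v (M *v w)) = 0"
      by (simp add: matrix_vector_mul_assoc)
    then have "(M *v w) \<bullet> (M *v w) = 0"
      by (metis dot_lmul_matrix inner_commute transpose_matrix_vector)
    then show ?thesis
      by (simp add: w_def matrix_vector_mult_diff_distrib)
  qed
  then show ?thesis
    by (simp add: matrix_eq matrix_vector_mul_assoc[symmetric])
qed

lemma generalized_inverse_exists:
  fixes M :: "real^'c^'r"
  shows "\<exists>G. M ** G ** M = M"
proof -
  obtain g where g: "linear g" "\<forall>v\<in>range ((*v) M). M *v g v = v"
    using linear_exists_right_inverse_on[of "(*v) M" UNIV] by auto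
  have "M ** matrix g ** M = M"
    using g by (simp add: matrix_eq matrix_vector_mul_assoc[symmetric] matrix_works)
  then show ?thesis by blast
qed

lemma penrose_conditions_ex1: "\<exists>!X. penrose_conditions M X"
proof (rule ex_ex1I)
  obtain G where G: "transpose M ** M ** G ** (transpose M ** M) = transpose M ** M"
    using generalized_inverse_exists by blast
  obtain F where F: "M ** transpose M ** F ** (M ** transpose M) = M ** transpose M"
    using generalized_inverse_exists by blast
  define U where "U = M ** G ** transpose M"
  define S where "S = transpose M ** F ** M"
  have UM: "U ** M = M"
    using matrix_inner_product_cancel[of M "G ** transpose M ** M" "mat 1"] G
    by (simp add: U_def matrix_mul_assoc)
  have SMt: "S ** transpose M = transpose M"
    using matrix_inner_product_cancel[of "transpose M" "F ** M ** transpose M" "mat 1"] F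
    by (simp add: S_def matrix_mul_assoc)
  have tU: "transpose M ** transpose U = transpose M"
    by (metis UM matrix_transpose_mul)
  have tS: "M ** transpose S = M"
    by (metis SMt matrix_transpose_mul transpose_transpose)
  have "U ** transpose U = U"
    by (metis U_def matrix_mul_assoc tU)
  then have symU: "transpose U = U"
    by (metis matrix_transpose_mul transpose_transpose)
  have "S ** transpose S = S"
    by (metis S_def matrix_mul_assoc tS)
  then have symS: "transpose S = S"
    by (metis matrix_transpose_mul transpose_transpose)
  define X where "X = S ** G ** transpose M"
  have MX: "M ** X = U"
    by (metis X_def U_def matrix_mul_assoc symS tS)
  have XM: "X ** M = S"
  proof -
    have "X ** M = transpose M ** F ** (U ** M)"
      by (simp add: X_def S_def U_def matrix_mul_assoc)
    then show ?thesis by (simp add: UM S_def)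
  qed
  have "S ** X = X"
    by (metis X_def S_def matrix_mul_assoc symS tS)
  then show "\<exists>X. penrose_conditions M X"
    unfolding penrose_conditions_def
    using MX XM UM symU symS by (intro exI[of _ X]) simp
next
  fix X Y
  assume "penrose_conditions M X" "penrose_conditions M Y"
  then have X: "M ** X ** M = M" "X ** M ** X = X"
      "transpose (M ** X) = M ** X" "transpose (X ** M) = X ** M"
    and Y: "M ** Y ** M = M" "Y ** M ** Y = Y"
      "transpose (M ** Y) = M ** Y" "transpose (Y ** M) = Y ** M"
    by (auto simp: penrose_conditions_def)
  have 1: "M ** X = M ** Y"
  proof -
    have "M ** Y = M ** X ** (M ** Y)" by (simp add: X(1) matrix_mul_assoc)
    then have "M ** Y = M ** Y ** (M ** X)"
      by (metis X(3) Y(3) matrix_transpose_mul)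
    then show ?thesis by (simp add: Y(1) matrix_mul_assoc)
  qed
  have 2: "X ** M = Y ** M"
  proof -
    have "X ** M = X ** M ** (Y ** M)" by (metis Y(1) matrix_mul_assoc)
    then have "X ** M = Y ** M ** (X ** M)"
      by (metis X(4) Y(4) matrix_transpose_mul)
    then show ?thesis by (metis X(1) matrix_mul_assoc)
  qed
  show "X = Y"
    by (metis 1 2 X(2) Y(2) matrix_mul_assoc)
qed


section \<open>Linear-quadratic control\<close>

definition riccati_solution ::
  "real^'n^'n \<Rightarrow> real^'m^'n \<Rightarrow> real^'n^'n \<Rightarrow> real^'m^'m \<Rightarrow> real^'n^'n \<Rightarrow> bool" where
  "riccati_solution A B Q R P \<longleftrightarrow>
     P = transpose A ** P ** A + Q
         - transpose A ** P ** B ** matrix_inv (R + transpose B ** P ** B) ** transpose B ** P ** A"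

definition riccati_gain ::
  "real^'n^'n \<Rightarrow> real^'m^'n \<Rightarrow> real^'m^'m \<Rightarrow> real^'n^'n \<Rightarrow> real^'n^'m" where
  "riccati_gain A B R P =
     - (matrix_inv (R + transpose B ** P ** B) ** transpose B ** P ** A)"

definition stage_cost ::
  "real^'n^'n \<Rightarrow> real^'m^'m \<Rightarrow> (nat \<Rightarrow> real^'n) \<Rightarrow> (nat \<Rightarrow> real^'m) \<Rightarrow> nat \<Rightarrow> real" where
  "stage_cost Q R E u k = quad_form Q (E k) + quad_form R (u k)"

definition cost_from ::
  "real^'n^'n \<Rightarrow> real^'m^'m \<Rightarrow> (nat \<Rightarrow> real^'n) \<Rightarrow> (nat \<Rightarrow> real^'m) \<Rightarrow> nat \<Rightarrow> real" where
  "cost_from Q R E u s = (\<Sum>k. stage_cost Q R E u (s + k))"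


section \<open>Feedforward control\<close>

text \<open>
  Here \<open>Ai\<close>, \<open>Bi\<close> belong to the follower, \<open>Aj\<close>, \<open>Bj\<close>, \<open>xj\<close>, \<open>uj\<close> to its parent, and \<open>ut\<close> is the
  feedforward input. Invertibility in case 1 forces \<open>'m\<close> and \<open>'n\<close> to have the same cardinality.
\<close>

definition feedforward_case1 ::
  "real^'n^'n \<Rightarrow> real^'m^'n \<Rightarrow> real^'n^'n \<Rightarrow> real^'m^'n \<Rightarrow>
   (nat \<Rightarrow> real^'n) \<Rightarrow> (nat \<Rightarrow> real^'m) \<Rightarrow> (nat \<Rightarrow> real^'m) \<Rightarrow> bool" where
  "feedforward_case1 Ai Bi Aj Bj xj uj ut \<longleftrightarrow>
     invertible Bi \<and>
     (\<forall>k. ut k = - ((matrix_inv Bi ** (Ai - Aj)) *v xj k) + (matrix_inv Bi ** Bj) *v uj k)"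

definition feedforward_case2 ::
  "real^'n^'n \<Rightarrow> real^'m^'n \<Rightarrow> real^'n^'n \<Rightarrow> real^'m^'n \<Rightarrow>
   (nat \<Rightarrow> real^'n) \<Rightarrow> (nat \<Rightarrow> real^'m) \<Rightarrow> (nat \<Rightarrow> real^'m) \<Rightarrow> (nat \<Rightarrow> real^'m) \<Rightarrow> bool" where
  "feedforward_case2 Ai Bi Aj Bj xj uj z ut \<longleftrightarrow>
     range ((*v) (col_join (Aj - Ai) Bj)) \<subseteq> range ((*v) Bi) \<and>
     (\<forall>k. ut k = - (moore_penrose Bi *v ((Ai - Aj) *v xj k - Bj *v uj k))
               + (mat 1 - moore_penrose Bi ** Bi) *v z k)"

end

theory Submission
  imports Defs "HOL-Computational_Algebra.Fundamental_Theorem_Algebra"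
begin

text \<open>
  Write \<open>F = At + Bt ** K\<close>. The pair (global error, stacked observer errors) is an orbit of the block
  triangular matrix with diagonal blocks \<open>F\<close> and \<open>Ac\<close>. The block \<open>Ac\<close> is stable by assumption; \<open>F\<close> is
  stable because the Riccati equation has only one positive definite solution. Hence this orbit is
  absolutely summable, and so is every quadratic form along it. By completing the square with
  the Riccati equation, each stage cost equals the decrease of \<open>quad_form P\<close> plus the correction term,
  and summing telescopes.
\<close>

section \<open>Block vectors and quadratic forms\<close>

text \<open>No hypothesis controls the centralized loop directly: \<open>Q\<close> is only
  semidefinite, and neither stabilizability nor detectability is assumed. Positive definiteness of
  \<open>P\<close> confines the eigenvalues of \<open>F\<close> to the closed unit disc; the circle
  itself is excluded by uniqueness, because a mode there would leave room to enlarge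
  \<open>P\<close> to another solution. Stability is given as a statement on eigenvalues, while the
  series need summable orbits. The bridge is an annihilating polynomial of the orbit, split over the
  complex numbers and stripped of one root at a time, in place of a Jordan form or a spectral radius
  formula. The correction term has a simple source: each agent feeds back its own estimate, so the
  joint input misses \<open>K *v E k\<close> by the stack of \<open>Ki i *v Etil i k\<close>. This
  deviation acts on the plant through \<open>Psi\<close> and on the cost through the weights
  \<open>R i\<close>.\<close>

lemma sum_UNIV_prod: "(\<Sum>p\<in>UNIV. f p) = (\<Sum>i\<in>UNIV. \<Sum>k\<in>UNIV. f (i, k))"
  for f :: "'a::finite \<times> 'b::finite \<Rightarrow> 'c::comm_monoid_add"
  by (simp add: sum.cartesian_product)

lemma sum_UNIV_sum: "(\<Sum>p\<in>UNIV. f p) = (\<Sum>i\<in>UNIV. f (Inl i)) + (\<Sum>k\<in>UNIV. f (Inr k))"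
  for f :: "'a::finite + 'b::finite \<Rightarrow> 'c::comm_monoid_add"
  by (simp add: UNIV_Plus_UNIV[symmetric] sum.Plus del: UNIV_Plus_UNIV)

lemma sum_if_const: "(\<Sum>k\<in>S. if b then f k else 0) = (if b then sum f S else 0)"
  by simp

lemma inner_transpose: "x \<bullet> (transpose M *v y) = (M *v x) \<bullet> y"
  for M :: "real^'n^'m"
  by (metis dot_lmul_matrix inner_commute transpose_matrix_vector)

lemma matrix_vector_mult_minus: "(- M) *v v = - (M *v v)" "M *v (- v) = - (M *v v)"
  for M :: "'a::ring_1^'n^'m"
  by (simp_all add: vec_eq_iff matrix_vector_mult_def sum_negf)

lemma matrix_vector_mult_sum_left: "(\<Sum>i\<in>S. M i) *v v = (\<Sum>i\<in>S. M i *v v)"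
  for M :: "'i \<Rightarrow> 'a::semiring_1^'n^'m"
  by (induction S rule: infinite_finite_induct) (simp_all add: matrix_vector_mult_add_rdistrib)

lemma stack_surj: obtains v where "w = stack v"
proof
  show "w = stack (\<lambda>i. \<chi> k. w $ (i, k))"
    by (simp add: stack_def vec_eq_iff)
qed

lemma stack_diff: "stack v - stack w = stack (\<lambda>i. v i - w i)"
  by (simp add: stack_def vec_eq_iff)

lemma stack_add: "stack v + stack w = stack (\<lambda>i. v i + w i)"
  by (simp add: stack_def vec_eq_iff)

lemma stack_eq_0_iff: "stack v = 0 \<longleftrightarrow> (\<forall>i. v i = 0)"
  by (auto simp: stack_def vec_eq_iff)

lemma inner_stack: "stack v \<bullet> stack w = (\<Sum>i\<in>UNIV. v i \<bullet> w i)"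
  by (simp add: stack_def inner_vec_def sum_UNIV_prod)

lemma diag_blocks_mult_stack: "diag_blocks M *v stack v = stack (\<lambda>i. M i *v v i)"
  for M :: "'b::finite \<Rightarrow> 'a::semiring_1^'c^'r"
  by (simp add: diag_blocks_def stack_def vec_eq_iff matrix_vector_mult_def sum_UNIV_prod
      if_distrib[of "\<lambda>c. c * _"] sum_if_const cong: if_cong)

lemma kronecker_mat_1: "kronecker (mat 1) M = diag_blocks (\<lambda>_. M)"
  for M :: "'a::semiring_1^'c^'r"
  by (simp add: kronecker_def diag_blocks_def mat_def vec_eq_iff)

lemma blocks_mult_stack: "blocks M *v stack v = stack (\<lambda>i. \<Sum>l\<in>UNIV. M i l *v v l)"
  for M :: "'b::finite \<Rightarrow> 'd::finite \<Rightarrow> 'a::semiring_1^'c^'r"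
  by (simp add: blocks_def stack_def vec_eq_iff matrix_vector_mult_def sum_UNIV_prod)

lemma row_of_blocks_mult_stack: "row_of_blocks M *v stack v = (\<Sum>i\<in>UNIV. M i *v v i)"
  for M :: "'d::finite \<Rightarrow> 'a::semiring_1^'c^'r"
  by (simp add: row_of_blocks_def stack_def vec_eq_iff matrix_vector_mult_def sum_UNIV_prod)

lemma mult_stack: "M *v stack v = (\<Sum>i\<in>UNIV. col_block M i *v v i)"
  for M :: "'a::semiring_1^('d::finite \<times> 'c::finite)^'r"
  by (simp add: col_block_def stack_def vec_eq_iff matrix_vector_mult_def sum_UNIV_prod)

lemma mult_eq_stack: "M *v v = stack (\<lambda>i. row_block M i *v v)"
  for M :: "'a::semiring_1^'c^('b::finite \<times> 'r::finite)"
  by (simp add: row_block_def stack_def vec_eq_iff matrix_vector_mult_def)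

lemma inner_vec_join: "vec_join v w \<bullet> vec_join v' w' = v \<bullet> v' + w \<bullet> w'"
  by (simp add: vec_join_def inner_vec_def sum_UNIV_sum)

lemma vec_join_surj: obtains v w where "x = vec_join v w"
proof
  show "x = vec_join (\<chi> i. x $ Inl i) (\<chi> i. x $ Inr i)"
    by (simp add: vec_join_def vec_eq_iff split: sum.split)
qed

lemma vec_join_eq_iff: "vec_join v w = vec_join v' w' \<longleftrightarrow> v = v' \<and> w = w'"
  by (auto simp: vec_join_def vec_eq_iff split: sum.splits)

lemma col_join_mult_vec_join: "col_join M N *v vec_join v w = M *v v + N *v w"
  for M :: "'a::semiring_1^'c^'r"
  by (simp add: col_join_def vec_join_def vec_eq_iff matrix_vector_mult_def sum_UNIV_sum)

lemma join_2x2_mult_vec_join: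
  "join_2x2 M11 M12 M21 M22 *v vec_join v w = vec_join (M11 *v v + M12 *v w) (M21 *v v + M22 *v w)"
  for M11 :: "'a::semiring_1^'c^'r"
  by (simp add: join_2x2_def col_join_def vec_join_def vec_eq_iff matrix_vector_mult_def sum_UNIV_sum
      split: sum.split)

text \<open>Look at the lower half \<open>w\<close> of an eigenvector: if nonzero, it is an
  eigenvector of \<open>D\<close>; if zero, the upper half is an eigenvector of
  \<open>F\<close>.\<close>

lemma complex_spectrum_block_triangular:
  "complex_spectrum (join_2x2 F G 0 D) \<subseteq> complex_spectrum F \<union> complex_spectrum D"
proof
  fix c assume "c \<in> complex_spectrum (join_2x2 F G 0 D)"
  moreover have "(\<chi> i j. complex_of_real (join_2x2 F G 0 D $ i $ j))
      = join_2x2 (\<chi> i j. complex_of_real (F $ i $ j)) (\<chi> i j. complex_of_real (G $ i $ j))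
          0 (\<chi> i j. complex_of_real (D $ i $ j))"
    by (simp add: join_2x2_def col_join_def vec_join_def vec_eq_iff split: sum.split)
  ultimately obtain x where x: "x \<noteq> 0"
    "join_2x2 (\<chi> i j. complex_of_real (F $ i $ j)) (\<chi> i j. complex_of_real (G $ i $ j))
          0 (\<chi> i j. complex_of_real (D $ i $ j)) *v x = c *s x"
    unfolding complex_spectrum_def by auto
  moreover obtain v w where "x = vec_join v w"
    by (rule vec_join_surj)
  moreover have "c *s vec_join v w = vec_join (c *s v) (c *s w)"
    by (simp add: vec_join_def vec_eq_iff split: sum.split)
  moreover have "vec_join v w = 0 \<longleftrightarrow> v = 0 \<and> w = 0"
    by (auto simp: vec_join_def vec_eq_iff split: sum.splits)
  ultimately show "c \<in> complex_spectrum F \<union> complex_spectrum D"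
    by (cases "w = 0") (auto simp: complex_spectrum_def join_2x2_mult_vec_join vec_join_eq_iff)
qed

section \<open>Growth and kernels of quadratic forms\<close>

lemma abs_quad_form_le: "\<exists>b\<ge>0. \<forall>v. \<bar>quad_form M v\<bar> \<le> b * (norm v)\<^sup>2"
  for M :: "real^'n^'n"
proof -
  obtain b where b: "b \<ge> 0" "\<And>v. norm (M *v v) \<le> norm v * b"
    using bounded_linear.nonneg_bounded[OF matrix_vector_mul_bounded_linear, of M] by blast
  have "\<bar>quad_form M v\<bar> \<le> b * (norm v)\<^sup>2" for v
  proof -
    have "\<bar>quad_form M v\<bar> \<le> norm v * norm (M *v v)"
      unfolding quad_form_def by (rule Cauchy_Schwarz_ineq2)
    also have "\<dots> \<le> norm v * (norm v * b)"
      by (intro mult_left_mono b) simp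
    finally show ?thesis by (simp add: power2_eq_square algebra_simps)
  qed
  then show ?thesis using b by blast
qed

text \<open>Summable norms are eventually below 1, and there the square is dominated by the norm
  itself.\<close>

lemma summable_quad_form:
  fixes M :: "real^'n^'n"
  assumes "summable (\<lambda>k. norm (f k))"
  shows "summable (\<lambda>k. quad_form M (f k))"
proof -
  obtain b where b: "b \<ge> 0" "\<And>v. \<bar>quad_form M v\<bar> \<le> b * (norm v)\<^sup>2"
    using abs_quad_form_le by blast
  have "eventually (\<lambda>k. norm (f k) < 1) sequentially"
    using summable_LIMSEQ_zero[OF assms] by (rule order_tendstoD) simp
  then have "eventually (\<lambda>k. norm (quad_form M (f k)) \<le> b * norm (f k)) sequentially"
  proof eventually_elim
    case (elim k)
    have "b * (norm (f k))\<^sup>2 \<le> b * norm (f k)"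
      using elim b(1) by (intro mult_left_mono) (auto simp: power2_eq_square intro: mult_left_le)
    then show ?case using b(2)[of "f k"] by simp
  qed
  then show ?thesis
    by (rule summable_comparison_test_ev) (intro summable_mult assms)
qed

lemma quad_form_sum_arg: "transpose M = M \<Longrightarrow>
  quad_form M (v + w) = quad_form M v + 2 * (v \<bullet> (M *v w)) + quad_form M w"
  using inner_transpose[of v M w]
  by (simp add: quad_form_def inner_add matrix_vector_right_distrib inner_commute)

lemma pos_semidef_kernel:
  assumes M: "sym_pos_semidef M" and "quad_form M v = 0"
  shows "M *v v = 0"
proof -
  define w where "w = M *v v"
  have sym: "transpose M = M" and nonneg: "\<And>y. 0 \<le> quad_form M y"
    using M by (auto simp: sym_pos_semidef_def)
  \<comment> \<open>The quadratic \<open>t \<mapsto> quad_form M (v + t w)\<close> is nonnegative and vanishes at \<open>0\<close>, so its slope is \<open>0\<close>.\<close>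
  have "0 \<le> 2 * t * (w \<bullet> w) + t\<^sup>2 * quad_form M w" for t
  proof -
    have "v \<bullet> (M *v w) = w \<bullet> w"
      using inner_transpose[of v M w] sym by (simp add: w_def)
    then have "quad_form M (v + t *\<^sub>R w) = 2 * t * (w \<bullet> w) + t\<^sup>2 * quad_form M w"
      using assms(2) quad_form_sum_arg[OF sym, of v "t *\<^sub>R w"]
      by (simp add: quad_form_def matrix_vector_mult_scaleR power2_eq_square)
    then show ?thesis using nonneg by metis
  qed
  note ge = this
  \<comment> \<open>The minimizer of the quadratic would be
    \<open>- (w \<bullet> w) / quad_form M w\<close>; the added 1 keeps the denominator positive
    when \<open>quad_form M w\<close> vanishes.\<close>
  define t where "t = - (w \<bullet> w) / (1 + quad_form M w)"
  have "t * (1 + quad_form M w) = - (w \<bullet> w)"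
    using nonneg[of w] by (simp add: t_def add_nonneg_eq_0_iff)
  then have "t * quad_form M w = - (w \<bullet> w) - t"
    by (simp add: algebra_simps)
  then have "t\<^sup>2 * quad_form M w = t * (- (w \<bullet> w) - t)"
    by (metis mult.assoc power2_eq_square)
  with ge[of t] have "t\<^sup>2 \<le> t * (w \<bullet> w)"
    by (simp add: algebra_simps power2_eq_square)
  moreover have "t \<le> 0"
    using nonneg[of w] by (simp add: t_def divide_nonpos_nonneg)
  then have "t * (w \<bullet> w) \<le> 0"
    by (simp add: mult_nonpos_nonneg)
  ultimately have "t = 0"
    by (smt (verit) zero_less_power2)
  then show ?thesis
    using nonneg[of w] by (auto simp: t_def w_def add_nonneg_eq_0_iff)
qed


section \<open>Orbits of stable matrices\<close>

lemma norm_vector_scalar_mult: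
  fixes v :: "complex^'n"
  shows "norm (c *s v) = cmod c * norm v"
  by (simp add: norm_vec_def norm_mult L2_set_right_distrib)

text \<open>Summing the recurrence bounds a partial sum by \<open>r\<close> times itself plus a
  constant; since \<open>r < 1\<close>, the former can be absorbed on the left.\<close>

lemma summable_norm_first_order_recurrence:
  fixes f g :: "nat \<Rightarrow> 'a::real_normed_vector"
  assumes rec: "\<And>k. norm (f (Suc k)) \<le> r * norm (f k) + norm (g k)"
    and r: "0 \<le> r" "r < 1" and g: "summable (\<lambda>k. norm (g k))"
  shows "summable (\<lambda>k. norm (f k))"
proof (rule summableI_nonneg_bounded)
  fix n
  let ?S = "\<Sum>k<n. norm (f k)" and ?W = "\<Sum>k. norm (g k)"
  have "?S \<le> (\<Sum>k<Suc n. norm (f k))" by simp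
  also have "\<dots> = norm (f 0) + (\<Sum>k<n. norm (f (Suc k)))"
    by (rule sum.lessThan_Suc_shift)
  also have "\<dots> \<le> norm (f 0) + (\<Sum>k<n. r * norm (f k) + norm (g k))"
    by (intro add_left_mono sum_mono rec)
  also have "\<dots> = norm (f 0) + r * ?S + (\<Sum>k<n. norm (g k))"
    by (simp add: sum.distrib sum_distrib_left)
  also have "\<dots> \<le> norm (f 0) + r * ?S + ?W"
    using sum_le_suminf[OF g, of "{..<n}"] by simp
  finally have "(1 - r) * ?S \<le> norm (f 0) + ?W"
    by (simp add: algebra_simps)
  then show "?S \<le> (norm (f 0) + ?W) / (1 - r)"
    using r by (simp add: field_simps)
qed simp

text \<open>The polynomial \<open>p\<close> in the shift operator, applied to the sequence
  \<open>f\<close> and read off at index 0. On an orbit of a matrix \<open>M\<close> it is p(M)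
  applied to \<open>f 0\<close>.\<close>

definition poly_shift :: "complex poly \<Rightarrow> (nat \<Rightarrow> complex^'n) \<Rightarrow> complex^'n" where
  "poly_shift p f = (\<Sum>i\<le>degree p. coeff p i *s f i)"

text \<open>A product of polynomials acts as a composition of operators, and X - c acts as the shift
  minus c. In the proof, \<open>pCons 0 q\<close> is X times \<open>q\<close>.\<close>

lemma poly_shift_linear_factor:
  assumes "q \<noteq> 0"
  shows "poly_shift ([:- c, 1:] * q) f = poly_shift q (\<lambda>k. f (Suc k) - c *s f k)"
proof -
  have deg: "degree ([:- c, 1:] * q) = Suc (degree q)"
    using assms by (subst degree_mult_eq) auto
  have "poly_shift ([:- c, 1:] * q) f
      = (\<Sum>i\<le>Suc (degree q). coeff (pCons 0 q) i *s f i)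
        - (\<Sum>i\<le>Suc (degree q). (c * coeff q i) *s f i)"
    unfolding poly_shift_def deg sum_subtractf[symmetric]
    by (rule sum.cong) (auto simp: vec_eq_iff algebra_simps)
  also have "(\<Sum>i\<le>Suc (degree q). coeff (pCons 0 q) i *s f i)
      = (\<Sum>i\<le>degree q. coeff q i *s f (Suc i))"
    by (subst sum.atMost_Suc_shift) (simp add: vec_eq_iff)
  also have "(\<Sum>i\<le>Suc (degree q). (c * coeff q i) *s f i)
      = (\<Sum>i\<le>degree q. (c * coeff q i) *s f i)"
    by (simp add: coeff_eq_0 vec_eq_iff)
  finally show ?thesis
    unfolding poly_shift_def sum_subtractf[symmetric]
    by (simp add: vec_eq_iff algebra_simps)
qed

text \<open>One vector more than the real dimension forces a linear relation among the first terms,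
  whose coefficients form the polynomial. Dependence is a property of sets, so a repeated term needs
  its own relation.\<close>

lemma poly_shift_annihilator_exists:
  fixes f :: "nat \<Rightarrow> complex^'n"
  shows "\<exists>p. p \<noteq> 0 \<and> poly_shift p f = 0"
proof -
  define N where "N = DIM(complex^'n)"
  obtain a :: "nat \<Rightarrow> real" where a: "(\<Sum>i\<le>N. a i *\<^sub>R f i) = 0" "\<exists>i\<le>N. a i \<noteq> 0"
  proof (cases "inj_on f {..N}")
    case True
    then have "card (f ` {..N}) = Suc N" by (simp add: card_image)
    then have "dependent (f ` {..N})"
      using independent_bound[of "f ` {..N}"] by (fastforce simp: N_def)
    then obtain b where b: "\<exists>v\<in>f ` {..N}. b v \<noteq> 0" "(\<Sum>v\<in>f ` {..N}. b v *\<^sub>R v) = 0"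
      by (subst (asm) dependent_finite) auto
    show ?thesis
    proof (rule that)
      show "(\<Sum>i\<le>N. (b \<circ> f) i *\<^sub>R f i) = 0"
        using b(2) unfolding sum.reindex[OF True] by simp
      show "\<exists>i\<le>N. (b \<circ> f) i \<noteq> 0" using b(1) by auto
    qed
  next
    case False
    then obtain s t where st: "s \<le> N" "t \<le> N" "s \<noteq> t" "f s = f t"
      by (auto simp: inj_on_def)
    show ?thesis
    proof (rule that)
      let ?a = "\<lambda>i. (if i = s then 1 else 0) - (if i = t then 1 else 0) :: real"
      show "(\<Sum>i\<le>N. ?a i *\<^sub>R f i) = 0"
        using st by (simp add: algebra_simps sum_subtractf if_distrib[of "\<lambda>c. c *\<^sub>R _"] cong: if_cong)
      show "\<exists>i\<le>N. ?a i \<noteq> 0" using st by (intro exI[of _ s]) auto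
    qed
  qed
  define p where "p = (\<Sum>i\<le>N. monom (complex_of_real (a i)) i)"
  have coeff_p: "coeff p i = (if i \<le> N then complex_of_real (a i) else 0)" for i
    by (simp add: p_def coeff_sum)
  have "p \<noteq> 0"
    using a(2) coeff_p by (metis coeff_0 of_real_eq_0_iff)
  have deg: "degree p \<le> N"
    by (rule degree_le) (simp add: coeff_p)
  have "poly_shift p f = (\<Sum>i\<le>N. coeff p i *s f i)"
    unfolding poly_shift_def using deg
    by (intro sum.mono_neutral_left) (auto simp: coeff_eq_0 vec_eq_iff)
  also have "\<dots> = (\<Sum>i\<le>N. a i *\<^sub>R f i)"
    by (intro sum.cong) (auto simp: coeff_p vec_eq_iff complex_eq_iff)
  finally show ?thesis using a(1) \<open>p \<noteq> 0\<close> by metis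
qed

text \<open>
  Split off a linear factor \<open>X - c\<close> of the annihilating polynomial. If \<open>cmod c < 1\<close>, the orbit satisfies a
  contracting first-order recurrence driven by a summable orbit; otherwise \<open>c\<close> is not an eigenvalue and
  the cofactor already annihilates the orbit.
\<close>

lemma summable_norm_orbit_annihilated:
  fixes M :: "complex^'n^'n"
  assumes eig: "\<And>c v. v \<noteq> 0 \<Longrightarrow> M *v v = c *s v \<Longrightarrow> cmod c < 1"
  shows "p \<noteq> 0 \<Longrightarrow> (\<And>k. f (Suc k) = M *v f k) \<Longrightarrow> poly_shift p f = 0
    \<Longrightarrow> summable (\<lambda>k. norm (f k))"
proof (induction "degree p" arbitrary: p f)
  case 0
  have deg: "degree p = 0" using 0(1) by simp
  moreover have "coeff p 0 \<noteq> 0"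
    using leading_coeff_neq_0[OF 0(2)] deg by simp
  ultimately have "f 0 = 0"
    using 0(4) by (simp add: poly_shift_def vec_eq_iff)
  have "f k = 0" for k
    by (induction k) (simp_all add: \<open>f 0 = 0\<close> 0(3))
  then show ?case by simp
next
  case (Suc d)
  have "\<not> constant (poly p)"
    using Suc.hyps(2) by (simp add: constant_degree)
  then obtain c where "poly p c = 0"
    using fundamental_theorem_of_algebra by blast
  then obtain q where p: "p = [:- c, 1:] * q"
    by (auto simp: poly_eq_0_iff_dvd)
  with Suc.prems(1) have q: "q \<noteq> 0" by auto
  have d: "d = degree q"
    using Suc.hyps(2) q by (subst (asm) p, subst (asm) degree_mult_eq) auto
  define g where "g k = f (Suc k) - c *s f k" for k
  have M_scale: "M *v (b *s v) = b *s (M *v v)" for b v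
    by (simp add: vec_eq_iff matrix_vector_mult_def sum_distrib_left algebra_simps)
  have g: "g (Suc k) = M *v g k" for k
    by (simp add: g_def Suc.prems(2) matrix_vector_mult_diff_distrib M_scale)
  have qg: "poly_shift q g = 0"
    using Suc.prems(3) poly_shift_linear_factor[OF q, of c f] unfolding p g_def by metis
  show ?case
  proof (cases "cmod c < 1")
    case True
    have sg: "summable (\<lambda>k. norm (g k))"
      using Suc.hyps(1)[OF d q, of g] g qg by blast
    show ?thesis
    proof (rule summable_norm_first_order_recurrence)
      show "norm (f (Suc k)) \<le> cmod c * norm (f k) + norm (g k)" for k
        using norm_triangle_ineq[of "c *s f k" "g k"]
        by (simp add: g_def norm_vector_scalar_mult)
    qed (use True sg in auto)
  next
    case False
    \<comment> \<open>On an orbit the shift agrees with \<open>M\<close>, so applying X - c before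
      \<open>q\<close> amounts to applying \<open>M\<close> minus c after it.\<close>
    have "M *v poly_shift q f - c *s poly_shift q f = poly_shift q g"
      by (simp add: poly_shift_def g_def Suc.prems(2) linear_sum[OF matrix_vector_mul_linear] M_scale
          vec_eq_iff sum_subtractf sum_distrib_left algebra_simps)
    then have "M *v poly_shift q f = c *s poly_shift q f"
      using qg by simp
    then have "poly_shift q f = 0"
      using eig False by blast
    then show ?thesis
      using Suc.hyps(1)[OF d q, of f] Suc.prems(2) by blast
  qed
qed

lemma summable_norm_orbit:
  fixes M :: "real^'n^'n" and f :: "nat \<Rightarrow> real^'n"
  assumes eig: "\<And>c. c \<in> complex_spectrum M \<Longrightarrow> cmod c < 1"
    and f: "\<And>k. f (Suc k) = M *v f k"
  shows "summable (\<lambda>k. norm (f k))"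
proof -
  define g :: "nat \<Rightarrow> complex^'n" where "g k = (\<chi> i. complex_of_real (f k $ i))" for k
  define Mc :: "complex^'n^'n" where "Mc = (\<chi> i j. complex_of_real (M $ i $ j))"
  have "g (Suc k) = Mc *v g k" for k
    by (simp add: g_def Mc_def f vec_eq_iff matrix_vector_mult_def)
  moreover have "cmod c < 1" if "v \<noteq> 0" "Mc *v v = c *s v" for c v
    using that by (intro eig) (auto simp: complex_spectrum_def Mc_def)
  moreover obtain q where "q \<noteq> 0" "poly_shift q g = 0"
    using poly_shift_annihilator_exists by blast
  ultimately have "summable (\<lambda>k. norm (g k))"
    using summable_norm_orbit_annihilated[of Mc q g] by blast
  then show ?thesis
    by (simp add: g_def norm_vec_def)
qed

text \<open>A real supremum dominates the members of a set only if the set is bounded above; a bound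
  for the operator norm supplies this.\<close>

lemma complex_spectrum_le_spectral_radius:
  fixes M :: "real^'n^'n"
  assumes "c \<in> complex_spectrum M"
  shows "cmod c \<le> matrix_spectral_radius M"
proof -
  define Mc :: "complex^'n^'n" where "Mc = (\<chi> i j. complex_of_real (M $ i $ j))"
  have "bounded_linear ((*v) Mc)"
    by (rule matrix_vector_mul_bounded_linear)
  then obtain b where b: "\<And>v. norm (Mc *v v) \<le> norm v * b"
    using bounded_linear.bounded by blast
  have "cmod d \<le> b" if d: "d \<in> complex_spectrum M" for d
  proof -
    obtain v where "v \<noteq> 0" "Mc *v v = d *s v"
      using d by (auto simp: complex_spectrum_def Mc_def)
    then show ?thesis
      using b[of v] by (simp add: norm_vector_scalar_mult mult.commute)
  qed
  then have "bdd_above (cmod ` complex_spectrum M)"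
    by (auto simp: bdd_above_def)
  then show ?thesis
    unfolding matrix_spectral_radius_def using assms by (intro cSUP_upper)
qed


section \<open>The Riccati equation and the stability of its closed loop\<close>

lemma matrix_inv_right: "invertible M \<Longrightarrow> M ** matrix_inv M = mat 1"
  unfolding invertible_def matrix_inv_def by (rule someI2_ex) auto

lemma pos_def_imp_invertible:
  assumes "sym_pos_def M" shows "invertible M"
proof -
  have "v = 0" if "M *v v = 0" for v
    using assms that by (auto simp: sym_pos_def_def quad_form_def)
  then show ?thesis
    unfolding invertible_left_inverse matrix_left_invertible_ker by blast
qed

lemma pos_def_nonneg: "sym_pos_def M \<Longrightarrow> 0 \<le> quad_form M v"
  unfolding sym_pos_def_def by (cases "v = 0") (auto simp: quad_form_def less_imp_le)

text \<open>In complex notation a + i b = (\<alpha> + i \<beta>)(x + i y), and on the unit circle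
  the inverse factor is the conjugate.\<close>

lemma rotation_inverse:
  fixes x y :: "'a::real_vector"
  assumes "a = \<alpha> *\<^sub>R x - \<beta> *\<^sub>R y" "b = \<beta> *\<^sub>R x + \<alpha> *\<^sub>R y" "\<alpha>\<^sup>2 + \<beta>\<^sup>2 = 1"
  shows "x = \<alpha> *\<^sub>R a + \<beta> *\<^sub>R b" "y = \<alpha> *\<^sub>R b - \<beta> *\<^sub>R a"
proof -
  have "\<alpha> *\<^sub>R a + \<beta> *\<^sub>R b = (\<alpha>\<^sup>2 + \<beta>\<^sup>2) *\<^sub>R x" "\<alpha> *\<^sub>R b - \<beta> *\<^sub>R a = (\<alpha>\<^sup>2 + \<beta>\<^sup>2) *\<^sub>R y"
    unfolding assms(1,2) by (simp_all add: power2_eq_square algebra_simps)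
  then show "x = \<alpha> *\<^sub>R a + \<beta> *\<^sub>R b" "y = \<alpha> *\<^sub>R b - \<beta> *\<^sub>R a"
    by (simp_all add: assms(3))
qed

lemma matrix_add_rdistrib: "(M + N) ** X = M ** X + N ** X"
  for M N :: "'a::semiring_1^'n^'m"
  by (simp add: matrix_matrix_mult_def vec_eq_iff sum.distrib algebra_simps)

text \<open>Uniqueness of \<open>P\<close> stays outside the locale: completing the square works for
  every positive definite solution, and only stability asks for uniqueness.\<close>

locale riccati =
  fixes A Q P :: "real^'n^'n" and B :: "real^'m^'n" and R :: "real^'m^'m"
  assumes Q: "sym_pos_semidef Q" and R: "sym_pos_def R"
    and P: "sym_pos_def P" and solution: "riccati_solution A B Q R P"
begin

section \<open>Optimality conditions of the linear-quadratic problem\<close>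

definition K where "K = riccati_gain A B R P"

definition closed_loop where "closed_loop = A + B ** K"

lemma closed_loop_apply: "closed_loop *v v = A *v v + B *v (K *v v)"
  by (simp add: closed_loop_def matrix_vector_mult_add_rdistrib matrix_vector_mul_assoc)

lemma P_sym: "transpose P = P" and R_sym: "transpose R = R"
  using P R by (auto simp: sym_pos_def_def)

lemma input_weight_pos_def: "sym_pos_def (R + transpose B ** P ** B)"
  unfolding sym_pos_def_def
proof (intro conjI allI impI)
  have "transpose (R + transpose B ** P ** B) = transpose R + transpose (transpose B ** P ** B)"
    by (simp add: transpose_def vec_eq_iff)
  then show "transpose (R + transpose B ** P ** B) = R + transpose B ** P ** B"
    by (simp add: R_sym P_sym matrix_transpose_mul matrix_mul_assoc)
  fix v :: "real^'m" assume "v \<noteq> 0"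
  then have "0 < quad_form R v"
    using R by (simp add: sym_pos_def_def)
  moreover have "quad_form (R + transpose B ** P ** B) v = quad_form R v + quad_form P (B *v v)"
    by (simp add: quad_form_def matrix_vector_mult_add_rdistrib inner_add_right inner_transpose
        matrix_vector_mul_assoc[symmetric] del: transpose_matrix_vector)
  ultimately show "0 < quad_form (R + transpose B ** P ** B) v"
    using pos_def_nonneg[OF P] by (simp add: add_pos_nonneg)
qed

lemma input_weight_gain:
  "(R + transpose B ** P ** B) ** K = - (transpose B ** P ** A)"
proof -
  have "(R + transpose B ** P ** B) ** matrix_inv (R + transpose B ** P ** B) = mat 1"
    using input_weight_pos_def by (intro matrix_inv_right pos_def_imp_invertible)
  then have "(R + transpose B ** P ** B) *v (K *v v) = (- (transpose B ** P ** A)) *v v" for v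
    unfolding K_def riccati_gain_def
    by (simp add: matrix_vector_mult_minus matrix_vector_mul_assoc matrix_mul_assoc)
  then show ?thesis by (simp add: matrix_eq matrix_vector_mul_assoc)
qed

text \<open>With \<open>P *v (closed_loop *v v)\<close> as the next costate, this is stationarity of
  the Hamiltonian in the input.\<close>

lemma input_costate: "transpose B *v (P *v (closed_loop *v v)) = - (R *v (K *v v))"
proof -
  have "((R + transpose B ** P ** B) ** K) *v v = (- (transpose B ** P ** A)) *v v"
    by (simp only: input_weight_gain)
  then have "R *v (K *v v) + transpose B *v (P *v (B *v (K *v v))) = - (transpose B *v (P *v (A *v v)))"
    by (simp add: matrix_vector_mult_add_rdistrib matrix_vector_mult_minus
        matrix_vector_mul_assoc[symmetric] del: transpose_matrix_vector)
  then show ?thesis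
    by (simp add: closed_loop_apply matrix_vector_right_distrib eq_neg_iff_add_eq_0 algebra_simps
        del: transpose_matrix_vector)
qed

text \<open>The adjoint recursion for the costate \<open>P *v v\<close>: the subtracted Riccati term
  is \<open>transpose A ** P ** B ** K\<close> up to sign, which turns \<open>A\<close> into the
  closed loop.\<close>

lemma costate: "P *v v = transpose A *v (P *v (closed_loop *v v)) + Q *v v"
proof -
  have "transpose A ** P ** B ** K = - (transpose A ** P ** B
      ** matrix_inv (R + transpose B ** P ** B) ** transpose B ** P ** A)"
    by (simp add: K_def riccati_gain_def matrix_eq matrix_vector_mult_minus
        matrix_vector_mul_assoc[symmetric] del: transpose_matrix_vector)
  then have "P = transpose A ** P ** A + Q + transpose A ** P ** B ** K"
    using solution[unfolded riccati_solution_def] by (metis add_uminus_conv_diff)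
  then have "P *v v = (transpose A ** P ** A + Q + transpose A ** P ** B ** K) *v v"
    by (rule arg_cong)
  also have "\<dots> = transpose A *v (P *v (closed_loop *v v)) + Q *v v"
    by (simp add: closed_loop_apply matrix_vector_mult_add_rdistrib matrix_vector_right_distrib
        matrix_vector_mul_assoc[symmetric] algebra_simps del: transpose_matrix_vector)
  finally show ?thesis .
qed

text \<open>The Bellman identity, obtained by pairing the adjoint recursion with \<open>v\<close>
  and stationarity with \<open>K *v v\<close>.\<close>

lemma value_decrease:
  "quad_form P (closed_loop *v v) = quad_form P v - quad_form Q v - quad_form R (K *v v)"
proof -
  let ?w = "P *v (closed_loop *v v)"
  have "quad_form P v = (A *v v) \<bullet> ?w + quad_form Q v"
    unfolding quad_form_def
    by (subst costate) (simp add: inner_add_right inner_transpose del: transpose_matrix_vector)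
  moreover have "(B *v (K *v v)) \<bullet> ?w = - quad_form R (K *v v)"
    by (simp add: inner_transpose[symmetric] input_costate quad_form_def
        del: transpose_matrix_vector)
  moreover have "quad_form P (closed_loop *v v) = (A *v v + B *v (K *v v)) \<bullet> ?w"
    by (simp add: quad_form_def closed_loop_apply)
  ultimately show ?thesis
    by (simp add: inner_add_left)
qed

text \<open>
  An eigenvalue \<open>\<alpha> + i \<beta>\<close> of the closed loop outside the open unit disc, with eigenvector
  \<open>v + i w\<close>, lies on the unit circle and is unobservable through the cost, so \<open>P v + i P w\<close> is an
  uncontrollable left eigenvector of \<open>A\<close>. Adding the corresponding rank-two matrix to \<open>P\<close> yields a
  second positive definite solution.
\<close>

lemma unstable_eigenpair_second_solution:
  assumes eig: "closed_loop *v v = \<alpha> *\<^sub>R v - \<beta> *\<^sub>R w" "closed_loop *v w = \<beta> *\<^sub>R v + \<alpha> *\<^sub>R w"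
    and nz: "v \<noteq> 0 \<or> w \<noteq> 0" and large: "1 \<le> \<alpha>\<^sup>2 + \<beta>\<^sup>2"
  shows "\<exists>P'. P' \<noteq> P \<and> sym_pos_def P' \<and> riccati_solution A B Q R P'"
proof -
  let ?V = "quad_form P v + quad_form P w"
  \<comment> \<open>\<open>?V\<close> is the Hermitian form of \<open>P\<close> at v + i w, so the
    eigenvalue scales it by its squared modulus; the cross terms cancel.\<close>
  have "quad_form P (closed_loop *v v) + quad_form P (closed_loop *v w) = (\<alpha>\<^sup>2 + \<beta>\<^sup>2) * ?V"
    using inner_transpose[of v P w]
    by (simp add: eig quad_form_def P_sym matrix_vector_right_distrib matrix_vector_mult_diff_distrib
        matrix_vector_mult_scaleR inner_diff inner_add inner_commute power2_eq_square algebra_simps)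
  moreover have "?V > 0"
    using nz P pos_def_nonneg[OF P, of v] pos_def_nonneg[OF P, of w]
    by (auto simp: sym_pos_def_def add_pos_nonneg add_nonneg_pos)
  then have "?V \<le> (\<alpha>\<^sup>2 + \<beta>\<^sup>2) * ?V" and eq1: "(\<alpha>\<^sup>2 + \<beta>\<^sup>2) * ?V = ?V \<Longrightarrow> \<alpha>\<^sup>2 + \<beta>\<^sup>2 = 1"
    using large by (auto simp: mult_le_cancel_right1)
  moreover have nonneg: "0 \<le> quad_form Q y" "0 \<le> quad_form R z" for y z
    using Q pos_def_nonneg[OF R] by (auto simp: sym_pos_semidef_def)
  \<comment> \<open>By \<open>value_decrease\<close> the four nonnegative stage costs sum to (1 -
    \<alpha>^2 - \<beta>^2) times \<open>?V\<close>, which is at most 0.\<close>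
  ultimately have zero: "quad_form Q v = 0" "quad_form Q w = 0"
    "quad_form R (K *v v) = 0" "quad_form R (K *v w) = 0" and "(\<alpha>\<^sup>2 + \<beta>\<^sup>2) * ?V = ?V"
    using nonneg(1)[of v] nonneg(1)[of w] nonneg(2)[of "K *v v"] nonneg(2)[of "K *v w"]
    unfolding value_decrease by linarith+
  from eq1 this(5) have unit: "\<alpha>\<^sup>2 + \<beta>\<^sup>2 = 1" by blast
  have Qz: "Q *v v = 0" "Q *v w = 0"
    using zero pos_semidef_kernel[OF Q] by auto
  have Kz: "K *v v = 0" "K *v w = 0"
    using zero(3,4) R unfolding sym_pos_def_def by (metis less_irrefl)+
  define a where "a = P *v v"
  define b where "b = P *v w"
  let ?T = "\<lambda>M c. transpose M *v (c::real^'n)"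
  \<comment> \<open>Without the \<open>Q\<close> term, the adjoint recursion says that a + i b is
    the eigenvalue times its image under the transpose of \<open>A\<close>; inverting the rotation
    makes it an eigenvector for the conjugate.\<close>
  have "a = \<alpha> *\<^sub>R ?T A a - \<beta> *\<^sub>R ?T A b" "b = \<beta> *\<^sub>R ?T A a + \<alpha> *\<^sub>R ?T A b"
    unfolding a_def b_def
    by (subst costate, simp add: Qz eig matrix_vector_right_distrib matrix_vector_mult_diff_distrib
        matrix_vector_mult_scaleR del: transpose_matrix_vector)+
  from rotation_inverse[OF this unit]
  have Aab: "?T A a = \<alpha> *\<^sub>R a + \<beta> *\<^sub>R b" "?T A b = \<alpha> *\<^sub>R b - \<beta> *\<^sub>R a" .
  have "0 = \<alpha> *\<^sub>R ?T B a - \<beta> *\<^sub>R ?T B b" "0 = \<beta> *\<^sub>R ?T B a + \<alpha> *\<^sub>R ?T B b"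
    using input_costate[of v] input_costate[of w]
    by (simp_all add: a_def b_def Kz eig matrix_vector_right_distrib matrix_vector_mult_diff_distrib
        matrix_vector_mult_scaleR del: transpose_matrix_vector)
  from rotation_inverse[OF this unit] have Bab: "?T B a = 0" "?T B b = 0"
    by simp_all
  have "a \<bullet> (B *v y) = 0" "b \<bullet> (B *v y) = 0" for y
    using inner_transpose[of y B a] inner_transpose[of y B b] Bab by (simp_all add: inner_commute)
  note aB = this
  \<comment> \<open>The real part of the Hermitian rank-one matrix of a + i b. The terms of the
    Riccati equation that contain \<open>B\<close> do not see it, and the remaining ones reproduce
    it because the eigenvalue has modulus 1.\<close>
  define D :: "real^'n^'n" where "D = (\<chi> i k. a $ i * a $ k + b $ i * b $ k)"
  have D_apply: "D *v y = (a \<bullet> y) *\<^sub>R a + (b \<bullet> y) *\<^sub>R b" for y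
    by (simp add: D_def vec_eq_iff matrix_vector_mult_def inner_vec_def sum_distrib_left
        sum_distrib_right sum.distrib algebra_simps)
  have D_sym: "transpose D = D"
    by (simp add: D_def transpose_def vec_eq_iff mult.commute)
  have DB: "D ** B = 0"
    by (simp add: matrix_eq matrix_vector_mul_assoc[symmetric] D_apply aB)
  then have "transpose (D ** B) = 0"
    by (simp add: transpose_def vec_eq_iff)
  then have BD: "transpose B ** D = 0"
    by (simp add: matrix_transpose_mul D_sym)
  have "transpose A *v (D *v (A *v y)) = D *v y" for y
  proof -
    have "transpose A *v (D *v (A *v y)) = (?T A a \<bullet> y) *\<^sub>R ?T A a + (?T A b \<bullet> y) *\<^sub>R ?T A b"
      by (simp add: D_apply matrix_vector_right_distrib matrix_vector_mult_scaleR
          inner_commute[of _ y] inner_transpose inner_commute[of "A *v y"] del: transpose_matrix_vector)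
    also have "\<dots> = (\<alpha>\<^sup>2 + \<beta>\<^sup>2) *\<^sub>R (D *v y)"
      unfolding Aab D_apply
      by (simp add: vec_eq_iff inner_add_left inner_diff_left power2_eq_square algebra_simps)
    finally show ?thesis by (simp add: unit)
  qed
  then have AD: "transpose A ** D ** A = D"
    by (simp add: matrix_eq matrix_vector_mul_assoc[symmetric] del: transpose_matrix_vector)
  have quad_D: "quad_form D y = (a \<bullet> y)\<^sup>2 + (b \<bullet> y)\<^sup>2" for y
    by (simp add: quad_form_def D_apply inner_add_right inner_commute[of y] power2_eq_square)
  have quad_PD: "quad_form (P + D) y = quad_form P y + quad_form D y" for y
    by (simp add: quad_form_def matrix_vector_mult_add_rdistrib inner_add_right)
  have "P + D \<noteq> P"
  proof
    assume "P + D = P"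
    then have "quad_form D v = 0" "quad_form D w = 0" by (simp_all add: quad_form_def)
    then have "quad_form P v = 0" "quad_form P w = 0"
      unfolding quad_D a_def b_def by (simp_all add: quad_form_def inner_commute)
    then show False using \<open>?V > 0\<close> by simp
  qed
  moreover have "sym_pos_def (P + D)"
  proof -
    have "transpose (P + D) = P + D"
      using P_sym D_sym by (simp add: transpose_def vec_eq_iff)
    moreover have "0 < quad_form (P + D) y" if "y \<noteq> 0" for y
      using P that unfolding quad_PD quad_D by (auto simp: sym_pos_def_def intro!: add_pos_nonneg)
    ultimately show ?thesis by (simp add: sym_pos_def_def)
  qed
  moreover have "riccati_solution A B Q R (P + D)"
  proof -
    have BPD: "transpose B ** (P + D) = transpose B ** P"
      using BD by (simp add: matrix_add_ldistrib)
    have APDB: "transpose A ** (P + D) ** B = transpose A ** P ** B"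
      using DB by (simp add: matrix_add_ldistrib matrix_add_rdistrib matrix_mul_assoc[symmetric])
    have APDA: "transpose A ** (P + D) ** A = transpose A ** P ** A + D"
      using AD by (simp add: matrix_add_ldistrib matrix_add_rdistrib)
    \<comment> \<open>Products associate to the left, which hides the factor
      \<open>transpose B ** P'\<close>; it must appear as a subterm for \<open>BPD\<close> to
      rewrite it.\<close>
    have regroup: "transpose A ** P' ** B ** X ** transpose B ** P' ** A
        = (transpose A ** P' ** B) ** X ** (transpose B ** P') ** A" for P' X
      by (simp add: matrix_mul_assoc)
    show ?thesis
      unfolding riccati_solution_def unfolding regroup unfolding BPD APDB APDA
      by (rule trans[OF arg_cong[OF solution[unfolded riccati_solution_def regroup], of "\<lambda>X. X + D"]])
        (simp only: diff_conv_add_uminus add_ac)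
  qed
  ultimately show ?thesis by blast
qed

lemma closed_loop_stable:
  assumes unique: "\<And>P'. sym_pos_def P' \<Longrightarrow> riccati_solution A B Q R P' \<Longrightarrow> P' = P"
    and c: "c \<in> complex_spectrum closed_loop"
  shows "cmod c < 1"
proof (rule ccontr)
  assume "\<not> cmod c < 1"
  then have "1 \<le> (cmod c)\<^sup>2" by (simp add: one_le_power)
  then have large: "1 \<le> (Re c)\<^sup>2 + (Im c)\<^sup>2" by (simp add: cmod_power2)
  obtain z where z: "z \<noteq> 0" "(\<chi> i j. complex_of_real (closed_loop $ i $ j)) *v z = c *s z"
    using c by (auto simp: complex_spectrum_def)
  define v where "v = (\<chi> i. Re (z $ i))"
  define w where "w = (\<chi> i. Im (z $ i))"
  have eq: "(\<Sum>k\<in>UNIV. complex_of_real (closed_loop $ i $ k) * z $ k) = c * z $ i" for i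
    using z(2) by (simp add: vec_eq_iff matrix_vector_mult_def)
  have "closed_loop *v v = Re c *\<^sub>R v - Im c *\<^sub>R w"
    using arg_cong[OF eq, of Re] by (simp add: v_def w_def vec_eq_iff matrix_vector_mult_def)
  moreover have "closed_loop *v w = Im c *\<^sub>R v + Re c *\<^sub>R w"
    using arg_cong[OF eq, of Im] by (simp add: v_def w_def vec_eq_iff matrix_vector_mult_def)
  moreover have "v \<noteq> 0 \<or> w \<noteq> 0"
    using z(1) by (auto simp: v_def w_def vec_eq_iff complex_eq_iff)
  ultimately show False
    using unstable_eigenpair_second_solution[of v "Re c" "Im c" w] large unique by blast
qed

end


section \<open>Costs and feedforward\<close>

context riccati begin

text \<open>Completing the square: \<open>g\<close> is the deviation from the optimal closed loop, \<open>d\<close> the deviation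
  of the input from the optimal feedback.\<close>

lemma stage_cost_telescope:
  assumes next_eq: "closed_loop *v v + g = v'"
  shows "quad_form Q v + quad_form R (K *v v - d)
    = quad_form P v - quad_form P v'
      + (2 * ((closed_loop *v v) \<bullet> (P *v g)) + quad_form P g
         - 2 * ((K *v v) \<bullet> (R *v d)) + quad_form R d)"
proof -
  have "quad_form P v' = quad_form P (closed_loop *v v)
      + 2 * ((closed_loop *v v) \<bullet> (P *v g)) + quad_form P g"
    using quad_form_sum_arg[OF P_sym] next_eq by metis
  moreover have "quad_form R (K *v v - d) = quad_form R (K *v v) - 2 * ((K *v v) \<bullet> (R *v d)) + quad_form R d"
    using quad_form_sum_arg[OF R_sym, of "K *v v" "- d"]
    by (simp add: quad_form_def matrix_vector_mult_minus)
  ultimately show ?thesis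
    by (simp add: value_decrease)
qed

end

text \<open>Summability of the orbit sends the terminal value to 0, so only the initial one survives
  the telescoping.\<close>

lemma sums_telescope_quad_form:
  fixes P :: "real^'n^'n"
  assumes step: "\<And>k. c k = quad_form P (f k) - quad_form P (f (Suc k)) + e k"
    and f: "summable (\<lambda>k. norm (f k))" and e: "summable e"
  shows "c sums (quad_form P (f 0) + suminf e)"
proof -
  have "(\<lambda>k. quad_form P (f k)) \<longlonglongrightarrow> 0"
    by (intro summable_LIMSEQ_zero summable_quad_form f)
  then have "(\<lambda>k. quad_form P (f k) - quad_form P (f (Suc k))) sums (quad_form P (f 0) - 0)"
    by (rule telescope_sums')
  from sums_add[OF this summable_sums[OF e]] show ?thesis
    by (simp add: step[abs_def])
qed

lemma suminf_tail_tendsto_0: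
  fixes f :: "nat \<Rightarrow> real"
  assumes "summable f"
  shows "(\<lambda>s. \<Sum>k. f (s + k)) \<longlonglongrightarrow> 0"
proof -
  have "(\<lambda>s. suminf f - sum f {..<s}) \<longlonglongrightarrow> suminf f - suminf f"
    by (intro tendsto_intros summable_LIMSEQ assms)
  moreover have "(\<Sum>k. f (s + k)) = suminf f - sum f {..<s}" for s
    using suminf_minus_initial_segment[OF assms, of s] by (simp add: add.commute)
  ultimately show ?thesis by simp
qed

text \<open>The feedforward cancels the mismatch with the parent, so that only \<open>ub\<close>
  drives the relative error.\<close>

lemma feedforward_tracking:
  assumes "feedforward_case1 Ai Bi Aj Bj xj uj ut \<or> feedforward_case2 Ai Bi Aj Bj xj uj z ut"
  shows "Bi *v ut k = (Aj - Ai) *v xj k + Bj *v uj k"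
  using assms
proof
  assume "feedforward_case1 Ai Bi Aj Bj xj uj ut"
  then have inv: "Bi ** matrix_inv Bi = mat 1"
    and ut: "ut k = - ((matrix_inv Bi ** (Ai - Aj)) *v xj k) + (matrix_inv Bi ** Bj) *v uj k"
    by (auto simp: feedforward_case1_def matrix_inv_right)
  show ?thesis
    unfolding ut matrix_vector_right_distrib matrix_vector_mult_minus matrix_vector_mul_assoc
      matrix_mul_assoc inv by (simp add: matrix_vector_mult_diff_rdistrib)
next
  assume *: "feedforward_case2 Ai Bi Aj Bj xj uj z ut"
  let ?w = "(Ai - Aj) *v xj k - Bj *v uj k"
  from * have ut: "ut k = - (moore_penrose Bi *v ?w) + (mat 1 - moore_penrose Bi ** Bi) *v z k"
    by (simp add: feedforward_case2_def)
  have penrose: "Bi ** moore_penrose Bi ** Bi = Bi"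
    using theI'[OF penrose_conditions_ex1[of Bi]]
    by (simp add: moore_penrose_def penrose_conditions_def)
  \<comment> \<open>The range condition writes the mismatch as \<open>Bi *v y\<close>, where
    \<open>Bi ** moore_penrose Bi\<close> acts as the identity; the free term in \<open>z\<close> is
    killed by \<open>Bi\<close>.\<close>
  have "col_join (Aj - Ai) Bj *v vec_join (xj k) (uj k) \<in> range ((*v) Bi)"
    using * by (auto simp: feedforward_case2_def)
  then obtain y where "col_join (Aj - Ai) Bj *v vec_join (xj k) (uj k) = Bi *v y"
    by blast
  from this[symmetric] have y: "Bi *v y = - ?w"
    by (simp add: col_join_mult_vec_join matrix_vector_mult_diff_rdistrib)
  have "Bi *v ut k = (Bi ** moore_penrose Bi) *v (- ?w) + (Bi - Bi ** moore_penrose Bi ** Bi) *v z k"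
    unfolding ut matrix_vector_right_distrib matrix_vector_mult_minus matrix_vector_mul_assoc
      matrix_vector_mult_diff_rdistrib[of _ _ "z k"] matrix_vector_mult_diff_distrib[of Bi]
    by (simp add: matrix_mul_assoc)
  also have "\<dots> = Bi *v y"
    unfolding y[symmetric] by (simp add: matrix_vector_mul_assoc penrose)
  finally show ?thesis
    by (simp add: y matrix_vector_mult_diff_rdistrib)
qed

section \<open>Definiteness of the block weights\<close>

lemma symmetric_matrix_entry:
  assumes "transpose M = M" shows "M $ i $ k = M $ k $ i"
proof -
  have "transpose M $ k $ i = M $ i $ k" by (simp add: transpose_def)
  then show ?thesis using assms by simp
qed

lemma kronecker_pos_semidef:
  assumes "sym_pos_semidef Q" shows "sym_pos_semidef (kronecker (mat 1 :: real^'b::finite^'b) Q)"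
  unfolding sym_pos_semidef_def
proof (intro conjI allI)
  have "Q $ i $ k = Q $ k $ i" for i k
    using assms by (intro symmetric_matrix_entry) (simp add: sym_pos_semidef_def)
  then show "transpose (kronecker (mat 1) Q) = kronecker (mat 1 :: real^'b^'b) Q"
    by (auto simp: kronecker_def transpose_def vec_eq_iff mat_def)
  fix w :: "real^('b \<times> 'a)"
  obtain v where "w = stack v" by (rule stack_surj)
  then show "0 \<le> quad_form (kronecker (mat 1) Q) w"
    using assms
    by (simp add: quad_form_def kronecker_mat_1 diag_blocks_mult_stack inner_stack sym_pos_semidef_def sum_nonneg)
qed

lemma diag_blocks_pos_def:
  fixes R :: "'b::finite \<Rightarrow> real^'a^'a"
  assumes R: "\<And>i. sym_pos_def (R i)"
  shows "sym_pos_def (diag_blocks R)"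
  unfolding sym_pos_def_def
proof (intro conjI allI impI)
  have "R l $ i $ k = R l $ k $ i" for l i k
    using R by (intro symmetric_matrix_entry) (simp add: sym_pos_def_def)
  then show "transpose (diag_blocks R) = diag_blocks R"
    by (auto simp: diag_blocks_def transpose_def vec_eq_iff)
  fix w :: "real^('b \<times> 'a)" assume "w \<noteq> 0"
  moreover obtain v where w: "w = stack v" by (rule stack_surj)
  ultimately obtain i where "v i \<noteq> 0"
    by (auto simp: stack_eq_0_iff)
  then have "0 < (\<Sum>i\<in>UNIV. quad_form (R i) (v i))"
    using R pos_def_nonneg[OF R] by (intro sum_pos2[of _ i]) (auto simp: sym_pos_def_def)
  then show "0 < quad_form (diag_blocks R) w"
    by (simp add: w quad_form_def diag_blocks_mult_stack inner_stack)
qed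


section \<open>Cost of the distributed controller\<close>

(* Agents are indexed by 'N option: None is the leader 0, Some i a follower. The i-th observation
   matrix has p i block rows H i r (r < p i), and L i r is the matching block column of the i-th
   observer gain, so that the product of gain and observation matrix is the sum of L i r ** H i r. *)
theorem theorem2:
  fixes G T :: "('N::finite option \<times> 'N option) set"
    and A :: "'N option \<Rightarrow> real^'n^'n"
    and B :: "'N option \<Rightarrow> real^'m^'n"
    and x :: "'N option \<Rightarrow> nat \<Rightarrow> real^'n"
    and u :: "'N option \<Rightarrow> nat \<Rightarrow> real^'m"
    and ut ub z :: "'N \<Rightarrow> nat \<Rightarrow> real^'m"
    and j :: "'N \<Rightarrow> 'N option"
    and E :: "nat \<Rightarrow> real^('N \<times> 'n)"
    and At P QQ :: "real^('N \<times> 'n)^('N \<times> 'n)"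
    and Bt :: "real^('N \<times> 'm)^('N \<times> 'n)"
    and Bti :: "'N \<Rightarrow> real^'m^('N \<times> 'n)"
    and Q :: "real^'n^'n"
    and R :: "'N \<Rightarrow> real^'m^'m"
    and RR :: "real^('N \<times> 'm)^('N \<times> 'm)"
    and K :: "real^('N \<times> 'n)^('N \<times> 'm)"
    and Ki :: "'N \<Rightarrow> real^('N \<times> 'n)^'m"
    and p :: "'N \<Rightarrow> nat"
    and H :: "'N \<Rightarrow> nat \<Rightarrow> real^('N \<times> 'n)^'n"
    and L :: "'N \<Rightarrow> nat \<Rightarrow> real^'n^('N \<times> 'n)"
    and Y :: "'N \<Rightarrow> nat \<Rightarrow> nat \<Rightarrow> real^'n"
    and Ehat Etil :: "'N \<Rightarrow> nat \<Rightarrow> real^('N \<times> 'n)"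
    and Ac M2 :: "real^('N \<times> ('N \<times> 'n))^('N \<times> ('N \<times> 'n))"
    and Psi M1 :: "real^('N \<times> ('N \<times> 'n))^('N \<times> 'n)"
    and Ecen :: "nat \<Rightarrow> nat \<Rightarrow> real^('N \<times> 'n)"
    and Jstar Jcen :: "nat \<Rightarrow> real"
    and corr :: "nat \<Rightarrow> real"
  assumes tree: "rooted_spanning_tree G None T"
    and parent: "\<And>i. j i = tree_parent T (Some i)"
    and leader: "B None = 0" "\<And>k. u None k = 0"
    and dynamics: "\<And>i k. x i (Suc k) = A i *v x i k + B i *v u i k"
    and input: "\<And>i k. u (Some i) k = ut i k + ub i k"
    and feedforward: "\<And>i.
        feedforward_case1 (A (Some i)) (B (Some i)) (A (j i)) (B (j i)) (x (j i)) (u (j i)) (ut i) \<or>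
        feedforward_case2 (A (Some i)) (B (Some i)) (A (j i)) (B (j i)) (x (j i)) (u (j i)) (z i) (ut i)"
    and E: "\<And>k. E k = stack (\<lambda>i. x (Some i) k - x (j i) k)"
    and At: "At = diag_blocks (\<lambda>i. A (Some i))"
    and Bt: "Bt = diag_blocks (\<lambda>i. B (Some i))"
    and Bti: "\<And>i. Bti i = col_block Bt i"
    and weights: "sym_pos_semidef Q" "\<And>i. sym_pos_def (R i)"
    and QQ: "QQ = kronecker (mat 1) Q"
    and RR: "RR = diag_blocks R"
    and P: "sym_pos_def P" "riccati_solution At Bt QQ RR P"
    and P_unique: "\<And>P'. sym_pos_def P' \<Longrightarrow> riccati_solution At Bt QQ RR P' \<Longrightarrow> P' = P"
    and K: "K = riccati_gain At Bt RR P"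
    and Ki: "\<And>i. Ki i = row_block K i"
    and H: "\<And>i r l. r < p i \<Longrightarrow> col_block (H i r) l = 0 \<or> col_block (H i r) l = mat 1"
    and Y: "\<And>i r k. r < p i \<Longrightarrow> Y i r k = H i r *v E k"
    and control: "\<And>i k. ub i k = Ki i *v Ehat i k"
    and observer: "\<And>i k. Ehat i (Suc k) =
        At *v Ehat i k + Bti i *v ub i k + (\<Sum>l\<in>UNIV - {i}. Bti l *v (Ki l *v Ehat i k))
        + (\<Sum>r<p i. L i r *v (Y i r k - H i r *v Ehat i k))"
    and Etil: "\<And>i k. Etil i k = E k - Ehat i k"
    and Ac: "Ac = blocks (\<lambda>i l. if l = i
        then At + Bt ** K - Bti i ** Ki i - (\<Sum>r<p i. L i r ** H i r)
        else - (Bti l ** Ki l))"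
    and stable: "matrix_spectral_radius Ac < 1"
    and Psi: "Psi = row_of_blocks (\<lambda>i. - (Bti i ** Ki i))"
    and M1: "M1 = transpose (At + Bt ** K) ** P ** Psi
        - row_of_blocks (\<lambda>i. transpose (Ki i) ** R i ** Ki i)"
    and M2: "M2 = diag_blocks (\<lambda>i. transpose (Ki i) ** R i ** Ki i) + transpose Psi ** P ** Psi"
    and Jstar: "\<And>s. Jstar s = cost_from QQ RR E (\<lambda>k. stack (\<lambda>i. ub i k)) s"
    \<comment> \<open>\<open>Ecen s\<close> is the trajectory under the centralized control started at time \<open>s\<close> in \<open>E s\<close>\<close>
    and Ecen: "\<And>s. Ecen s s = E s"
        "\<And>s k. s \<le> k \<Longrightarrow> Ecen s (Suc k) = At *v Ecen s k + Bt *v (K *v Ecen s k)"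
    and Jcen: "\<And>s. Jcen s = cost_from QQ RR (Ecen s) (\<lambda>k. K *v Ecen s k) s"
    and corr: "\<And>k. corr k = quad_form (join_2x2 0 M1 (transpose M1) M2)
        (vec_join (E k) (stack (\<lambda>i. Etil i k)))"
  shows "(\<forall>s. summable (\<lambda>k. stage_cost QQ RR E (\<lambda>k. stack (\<lambda>i. ub i k)) (s + k))
            \<and> summable (\<lambda>k. corr (s + k))
            \<and> Jstar s = quad_form P (E s) + (\<Sum>k. corr (s + k)))
       \<and> (\<forall>s. summable (\<lambda>k. stage_cost QQ RR (Ecen s) (\<lambda>k. K *v Ecen s k) (s + k))
            \<and> Jcen s = quad_form P (E s)
            \<and> Jstar s - Jcen s = (\<Sum>k. corr (s + k)))
       \<and> (\<lambda>s. Jstar s - Jcen s) \<longlonglongrightarrow> 0"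
proof -
  have "sym_pos_semidef QQ" "sym_pos_def RR"
    unfolding QQ RR by (intro kronecker_pos_semidef diag_blocks_pos_def weights)+
  then interpret lqr: riccati At QQ P Bt RR
    using P by unfold_locales
  have lqr_K: "lqr.K = K"
    by (simp add: lqr.K_def K)
  define F where "F = At + Bt ** K"
  have lqr_F: "lqr.closed_loop = F"
    by (simp add: lqr.closed_loop_def lqr_K F_def)
  have F_apply: "F *v v = At *v v + Bt *v (K *v v)" for v
    using lqr.closed_loop_apply by (simp add: lqr_F lqr_K)
  have Bt_stack: "Bt *v stack v = (\<Sum>l\<in>UNIV. Bti l *v v l)" for v
    by (simp add: mult_stack Bti)
  have K_stack: "K *v v = stack (\<lambda>l. Ki l *v v)" for v
    by (simp add: mult_eq_stack[of K] Ki)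
  define S where "S k = stack (\<lambda>i. Etil i k)" for k
  define d where "d k = stack (\<lambda>i. Ki i *v Etil i k)" for k
  have Ehat_eq: "Ehat i k = E k - Etil i k" for i k
    by (simp add: Etil)
  have ub_stack: "stack (\<lambda>i. ub i k) = K *v E k - d k" for k
    by (simp add: K_stack d_def stack_diff control Ehat_eq matrix_vector_mult_diff_distrib)
  have Psi_S: "Psi *v S k = - (Bt *v d k)" for k
    by (simp add: Psi S_def d_def row_of_blocks_mult_stack Bt_stack matrix_vector_mult_minus
        matrix_vector_mul_assoc sum_negf)
  have E_input: "E (Suc k) = At *v E k + Bt *v stack (\<lambda>i. ub i k)" for k
  proof -
    have "x (Some i) (Suc k) - x (j i) (Suc k)
        = A (Some i) *v (x (Some i) k - x (j i) k) + B (Some i) *v ub i k" for i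
      using feedforward_tracking[OF feedforward[of i], of k]
      by (simp add: dynamics input matrix_vector_right_distrib matrix_vector_mult_diff_distrib
          matrix_vector_mult_diff_rdistrib)
    then show ?thesis
      by (simp add: E At Bt diag_blocks_mult_stack stack_add)
  qed
  then have E_step: "E (Suc k) = F *v E k + Psi *v S k" for k
    by (simp add: ub_stack F_apply Psi_S matrix_vector_mult_diff_distrib)
  \<comment> \<open>Observer \<open>i\<close> simulates all inputs from its own estimate, while the
    plant receives inputs built from every agent's estimate. The mismatch \<open>Psi *v S k\<close>
    couples the errors and yields the terms \<open>Bti l ** Ki l\<close> of
    \<open>Ac\<close>.\<close>
  have S_step: "S (Suc k) = Ac *v S k" for k
  proof -
    define G where "G i = (\<Sum>r<p i. L i r ** H i r)" for i
    have "Etil i (Suc k) = (\<Sum>l\<in>UNIV. (if l = i then F - Bti i ** Ki i - G i else - (Bti l ** Ki l)) *v Etil l k)"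
      for i
    proof -
      have "(\<Sum>r<p i. L i r *v (Y i r k - H i r *v Ehat i k)) = G i *v Etil i k"
        unfolding G_def matrix_vector_mult_sum_left
        by (intro sum.cong) (simp_all add: Y Ehat_eq matrix_vector_mult_diff_distrib
            matrix_vector_mul_assoc)
      moreover have "Bti i *v ub i k + (\<Sum>l\<in>UNIV - {i}. Bti l *v (Ki l *v Ehat i k))
          = Bt *v (K *v Ehat i k)"
        by (simp add: K_stack Bt_stack control sum.remove[of UNIV i])
      ultimately have Ehat_step: "Ehat i (Suc k) = F *v Ehat i k + G i *v Etil i k"
        using observer[of i k] by (simp add: F_apply)
      have "Etil i (Suc k) = F *v Etil i k - G i *v Etil i k + Psi *v S k"
        unfolding Etil[of i "Suc k"] E_step Ehat_step
        by (simp add: Ehat_eq matrix_vector_mult_diff_distrib)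
      moreover have "Psi *v S k = - ((Bti i ** Ki i) *v Etil i k)
          + (\<Sum>l\<in>UNIV - {i}. (- (Bti l ** Ki l)) *v Etil l k)"
        by (simp add: Psi S_def row_of_blocks_mult_stack sum.remove[of UNIV i] matrix_vector_mult_minus)
      ultimately show ?thesis
        by (simp add: sum.remove[of UNIV i] matrix_vector_mult_diff_rdistrib)
    qed
    then show ?thesis
      unfolding S_def Ac blocks_mult_stack F_def[symmetric] G_def[symmetric] by simp
  qed
  define W where "W k = vec_join (E k) (S k)" for k
  have F_stable: "cmod c < 1" if "c \<in> complex_spectrum F" for c
    using lqr.closed_loop_stable[OF P_unique] that by (simp add: lqr_F)
  have W_summable: "summable (\<lambda>k. norm (W k))"
  proof (rule summable_norm_orbit)
    show "W (Suc k) = join_2x2 F Psi 0 Ac *v W k" for k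
      by (simp add: W_def join_2x2_mult_vec_join E_step S_step)
    show "cmod c < 1" if "c \<in> complex_spectrum (join_2x2 F Psi 0 Ac)" for c
      using that complex_spectrum_block_triangular[of F Psi Ac] F_stable
        complex_spectrum_le_spectral_radius[of c Ac] stable by fastforce
  qed
  have E_summable: "summable (\<lambda>k. norm (E k))"
    using W_summable
    by (rule summable_comparison_test') (simp add: W_def norm_le inner_vec_join)
  have corr_summable: "summable corr"
    using summable_quad_form[OF W_summable] by (simp add: W_def S_def corr[abs_def])
  \<comment> \<open>\<open>M1\<close> and \<open>M2\<close> collect what completing the square
    leaves for the plant deviation \<open>Psi *v S k\<close> and the input deviation
    \<open>d k\<close>; the blocks built from \<open>Ki i\<close> and \<open>R i\<close> combine to
    \<open>RR\<close> acting on \<open>d k\<close>.\<close>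
  have corr_eq: "corr k = 2 * ((F *v E k) \<bullet> (P *v (Psi *v S k))) + quad_form P (Psi *v S k)
      - 2 * ((K *v E k) \<bullet> (RR *v d k)) + quad_form RR (d k)" for k
  proof -
    have "corr k = 2 * (E k \<bullet> (M1 *v S k)) + quad_form M2 (S k)"
      unfolding corr S_def[symmetric] quad_form_def join_2x2_mult_vec_join inner_vec_join
      by (simp add: inner_add_right inner_transpose inner_commute del: transpose_matrix_vector)
    moreover have "E k \<bullet> (M1 *v S k) = (F *v E k) \<bullet> (P *v (Psi *v S k)) - (K *v E k) \<bullet> (RR *v d k)"
      unfolding M1 F_def[symmetric] RR
      by (simp add: matrix_vector_mult_diff_rdistrib matrix_vector_mul_assoc[symmetric]
          inner_diff_right inner_transpose S_def d_def row_of_blocks_mult_stack inner_sum_right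
          K_stack diag_blocks_mult_stack inner_stack del: transpose_matrix_vector)
    moreover have "quad_form M2 (S k) = quad_form RR (d k) + quad_form P (Psi *v S k)"
      unfolding M2 RR quad_form_def matrix_vector_mult_add_rdistrib inner_add_right
      by (simp add: matrix_vector_mul_assoc[symmetric]
          inner_transpose S_def d_def diag_blocks_mult_stack inner_stack del: transpose_matrix_vector)
    ultimately show ?thesis by simp
  qed
  let ?c = "stage_cost QQ RR E (\<lambda>k. stack (\<lambda>i. ub i k))"
  have "?c k = quad_form P (E k) - quad_form P (E (Suc k)) + corr k" for k
    unfolding stage_cost_def ub_stack corr_eq
    using lqr.stage_cost_telescope[OF E_step[symmetric, folded lqr_F]] by (simp add: lqr_F lqr_K)
  then have star: "(\<lambda>k. ?c (s + k)) sums (quad_form P (E s) + (\<Sum>k. corr (s + k)))" for s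
    using sums_telescope_quad_form[of "\<lambda>k. ?c (s + k)" P "\<lambda>k. E (s + k)" "\<lambda>k. corr (s + k)"]
      E_summable corr_summable summable_iff_shift[of "\<lambda>k. norm (E k)" s] summable_iff_shift[of corr s]
    by (simp add: add.commute)
  let ?cen = "\<lambda>s. stage_cost QQ RR (Ecen s) (\<lambda>k. K *v Ecen s k)"
  have cen: "(\<lambda>k. ?cen s (s + k)) sums quad_form P (E s)" for s
  proof -
    \<comment> \<open>\<open>Ecen s\<close> is prescribed only from time \<open>s\<close> on, hence
      the shifted index. Both deviations are 0 here, so no correction remains.\<close>
    have step: "Ecen s (Suc (s + k)) = F *v Ecen s (s + k)" for k
      using Ecen(2)[of s "s + k"] by (simp add: F_apply)
    have "?cen s (s + k) = quad_form P (Ecen s (s + k)) - quad_form P (Ecen s (s + Suc k)) + 0" for k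
      using lqr.stage_cost_telescope[of "Ecen s (s + k)" 0 "Ecen s (s + Suc k)" 0] step[of k]
      by (simp add: stage_cost_def lqr_F lqr_K quad_form_def)
    from sums_telescope_quad_form[of "\<lambda>k. ?cen s (s + k)", OF this]
    show ?thesis
      using summable_norm_orbit[of F "\<lambda>k. Ecen s (s + k)", OF F_stable] step by (simp add: Ecen(1))
  qed
  have Jstar_eq: "Jstar s = quad_form P (E s) + (\<Sum>k. corr (s + k))" for s
    unfolding Jstar cost_from_def using star by (rule sums_unique[symmetric])
  have Jcen_eq: "Jcen s = quad_form P (E s)" for s
    unfolding Jcen cost_from_def using cen by (rule sums_unique[symmetric])
  have "summable (\<lambda>k. corr (s + k))" for s
    using corr_summable summable_iff_shift[of corr s] by (simp add: add.commute)
  then show ?thesis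
    using star cen suminf_tail_tendsto_0[OF corr_summable]
    by (auto simp: Jstar_eq Jcen_eq intro: sums_summable)
qed

end
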